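(* The total gravitational force acting on an outside particle by a body with spherically symmetric mass distribution is equal to that of a point mass of its total mass situated at its center. Precisely: let $O\in\mathbb{R}^3$, $R_0>0$, and let $\mu$ be a finite (nonnegative) Borel measure on $\mathbb{R}^3$ (the mass distribution of the body), supported in the closed ball of radius $R_0$ centered at $O$ and invariant under all rotations about $O$. Let $M=\mu(\mathbb{R}^3)$ be its total mass. Then for every point $P$ with $|\overrightarrow{OP}|>R_0$ and every particle of mass $m_1>0$ at $P$, the total gravitational force exerted by the body on the particle is $$\int_{\mathbb{R}^3} G\,m_1\,\frac{\overrightarrow{PQ}}{|\overrightarrow{PQ}|^3}\,d\mu(Q)=G\,m_1 M\,\frac{\overrightarrow{PO}}{|\overrightarrow{PO}|^3}.$$
   Context: $G>0$ is the gravitational constant. Newtonian (inverse square) gravitation: a point mass $m_2$ at $Q$ acts on a point mass $m_1$ at $P\neq Q$ by a force of magnitude $Gm_1m_2/|\overrightarrow{PQ}|^2$ directed from $P$ towards $Q$, i.e. by the force vector $Gm_1m_2\,\overrightarrow{PQ}/|\overrightarrow{PQ}|^3$; the force of an extended body is the (vector) integral of the forces of its mass elements. *)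

theory Defs
  imports "HOL-Analysis.Analysis"
begin

text \<open>
  Rotations are the orientation-preserving ones (orthogonal matrices of determinant 1);
  invariance under reflections is not required.
\<close>

definition rotation_about :: "real^3 \<Rightarrow> real^3^3 \<Rightarrow> real^3 \<Rightarrow> real^3" where
  "rotation_about C A x = C + A *v (x - C)"

definition spherically_symmetric :: "real^3 \<Rightarrow> (real^3) measure \<Rightarrow> bool" where
  "spherically_symmetric C \<mu> \<longleftrightarrow>
     (\<forall>A. rotation_matrix A \<longrightarrow> distr \<mu> borel (rotation_about C A) = \<mu>)"

definition supported_in :: "(real^3) measure \<Rightarrow> (real^3) set \<Rightarrow> bool" where
  "supported_in \<mu> S \<longleftrightarrow> emeasure \<mu> (- S) = 0"

end

theory Submission
  imports Defs
begin

text \<open>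
  Put the center at the origin and let \<open>F p\<close> be the attraction at \<open>p\<close>. Rotational symmetry gives
  \<open>F (A p) = A (F p)\<close> for every rotation \<open>A\<close>; a half turn about the axis through \<open>p\<close> then shows that
  \<open>F p\<close> is parallel to \<open>p\<close>, so \<open>F\<close> is determined by its radial component \<open>\<phi> r = F (r e) \<bullet> e\<close>
  along one unit vector \<open>e\<close>. Differentiating under the integral, \<open>F\<close> is divergence free outside the
  body. At \<open>r e\<close> each of the two transverse directions contributes \<open>\<phi> r / r\<close> to the divergence and
  the radial one \<open>\<phi>' r\<close>, hence \<open>\<phi>' = - 2 \<phi> / r\<close> and \<open>r\<^sup>2 \<phi> r\<close> is constant. Its limit for
  \<open>r \<rightarrow> \<infinity>\<close> is minus the total mass.
\<close>

section \<open>Differentiation under the integral sign\<close>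

text \<open>Bridge from the Frechet form of the derivative to limits of difference quotients, the
  form to which dominated convergence applies.\<close>

lemma has_vector_derivative_iff_quotient:
  "(f has_vector_derivative D) (at x within S) \<longleftrightarrow>
    ((\<lambda>y. (f y - f x) /\<^sub>R (y - x)) \<longlongrightarrow> D) (at x within S)"
proof -
  have "((\<lambda>y. (f y - f x) /\<^sub>R (y - x)) \<longlongrightarrow> D) (at x within S) \<longleftrightarrow>
      ((\<lambda>y. norm ((f y - f x) /\<^sub>R (y - x) - D)) \<longlongrightarrow> 0) (at x within S)"
    by (simp only: tendsto_norm_zero_iff LIM_zero_iff)
  also have "\<dots> \<longleftrightarrow> ((\<lambda>y. norm (f y - f x - (y - x) *\<^sub>R D) / norm (y - x)) \<longlongrightarrow> 0) (at x within S)"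
  proof (rule filterlim_cong[OF refl refl])
    show "\<forall>\<^sub>F y in at x within S. norm ((f y - f x) /\<^sub>R (y - x) - D)
        = norm (f y - f x - (y - x) *\<^sub>R D) / norm (y - x)"
      unfolding eventually_at_filter
    proof (rule always_eventually, intro allI impI)
      fix y assume "y \<noteq> x"
      then have "(f y - f x) /\<^sub>R (y - x) - D = (f y - f x - (y - x) *\<^sub>R D) /\<^sub>R (y - x)"
        by (simp add: scaleR_diff_right)
      then show "norm ((f y - f x) /\<^sub>R (y - x) - D)
        = norm (f y - f x - (y - x) *\<^sub>R D) / norm (y - x)"
        by (simp add: divide_inverse mult.commute)
    qed
  qed
  finally show ?thesis
    by (simp add: has_vector_derivative_def has_derivative_iff_norm bounded_linear_scaleR_left)
qed

text \<open>Dominated convergence for the difference quotients at \<open>x\<close>: the mean value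
  inequality on the convex set \<open>S\<close> turns the bound \<open>w\<close> on the derivative
  into a bound on the quotients.\<close>

lemma has_vector_derivative_integral:
  fixes f :: "real \<Rightarrow> 'a \<Rightarrow> 'b :: {banach, second_countable_topology}"
  assumes "open S" "convex S" "x \<in> S"
    and int: "\<And>t. t \<in> S \<Longrightarrow> integrable M (f t)"
    and meas: "f' x \<in> borel_measurable M"
    and deriv: "AE q in M. \<forall>t\<in>S. ((\<lambda>t. f t q) has_vector_derivative f' t q) (at t)"
    and bound: "AE q in M. \<forall>t\<in>S. norm (f' t q) \<le> w q"
    and w: "integrable M w"
  shows "((\<lambda>t. integral\<^sup>L M (f t)) has_vector_derivative integral\<^sup>L M (f' x)) (at x)"
proof -
  have "((\<lambda>t. (integral\<^sup>L M (f t) - integral\<^sup>L M (f x)) /\<^sub>R (t - x)) \<longlongrightarrow> integral\<^sup>L M (f' x))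
      (at x within S)"
    \<comment> \<open>Testing the limit on sequences in \<open>S - {x}\<close> makes the sequential
      dominated convergence theorem applicable.\<close>
    unfolding tendsto_at_iff_sequentially comp_def
  proof (intro allI impI)
    fix X assume X: "\<forall>n. X n \<in> S - {x}" "X \<longlonglongrightarrow> x"
    have "(\<lambda>n. integral\<^sup>L M (\<lambda>q. (f (X n) q - f x q) /\<^sub>R (X n - x))) \<longlonglongrightarrow> integral\<^sup>L M (f' x)"
    proof (rule integral_dominated_convergence[OF meas _ w])
      fix n
      have [measurable]: "f (X n) \<in> borel_measurable M" "f x \<in> borel_measurable M"
        using int X \<open>x \<in> S\<close> by (auto intro: borel_measurable_integrable)
      show "(\<lambda>q. (f (X n) q - f x q) /\<^sub>R (X n - x)) \<in> borel_measurable M"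
        by measurable
      show "AE q in M. norm ((f (X n) q - f x q) /\<^sub>R (X n - x)) \<le> w q"
        using deriv bound
      proof eventually_elim
        fix q
        assume d: "\<forall>t\<in>S. ((\<lambda>t. f t q) has_vector_derivative f' t q) (at t)"
          and b: "\<forall>t\<in>S. norm (f' t q) \<le> w q"
        have "norm (f (X n) q - f x q) \<le> w q * norm (X n - x)"
        proof (rule differentiable_bound[OF \<open>convex S\<close>])
          fix t assume "t \<in> S"
          then show "((\<lambda>t. f t q) has_derivative (\<lambda>h. h *\<^sub>R f' t q)) (at t within S)"
            using d by (auto simp: has_vector_derivative_def intro: has_derivative_at_withinI)
          show "onorm (\<lambda>h. h *\<^sub>R f' t q) \<le> w q"
            using b \<open>t \<in> S\<close>
            by (intro onorm_bound)
              (auto simp: mult.commute mult_left_mono intro: order_trans[OF norm_ge_zero])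
        qed (use X \<open>x \<in> S\<close> in auto)
        then show "norm ((f (X n) q - f x q) /\<^sub>R (X n - x)) \<le> w q"
          using X(1) by (auto simp: divide_simps)
      qed
      show "AE q in M. (\<lambda>n. (f (X n) q - f x q) /\<^sub>R (X n - x)) \<longlonglongrightarrow> f' x q"
        using deriv
      proof eventually_elim
        fix q
        assume "\<forall>t\<in>S. ((\<lambda>t. f t q) has_vector_derivative f' t q) (at t)"
        then have "((\<lambda>t. f t q) has_vector_derivative f' x q) (at x within S)"
          using \<open>x \<in> S\<close> by (simp add: has_vector_derivative_at_within)
        then have "((\<lambda>t. (f t q - f x q) /\<^sub>R (t - x)) \<longlongrightarrow> f' x q) (at x within S)"
          by (rule has_vector_derivative_iff_quotient[THEN iffD1])
        then show "(\<lambda>n. (f (X n) q - f x q) /\<^sub>R (X n - x)) \<longlonglongrightarrow> f' x q"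
          using X by (auto simp: tendsto_at_iff_sequentially comp_def)
      qed
    qed
    moreover have "integral\<^sup>L M (\<lambda>q. (f (X n) q - f x q) /\<^sub>R (X n - x))
        = (integral\<^sup>L M (f (X n)) - integral\<^sup>L M (f x)) /\<^sub>R (X n - x)" for n
      using int X \<open>x \<in> S\<close> by simp
    ultimately show "(\<lambda>n. (integral\<^sup>L M (f (X n)) - integral\<^sup>L M (f x)) /\<^sub>R (X n - x))
        \<longlonglongrightarrow> integral\<^sup>L M (f' x)"
      by (simp only:)
  qed
  then show ?thesis
    unfolding at_within_open[OF \<open>x \<in> S\<close> \<open>open S\<close>]
    by (rule has_vector_derivative_iff_quotient[THEN iffD2])
qed

section \<open>The inverse square kernel and its derivative\<close>

text \<open>Force on a unit mass at \<open>p\<close> by a unit mass at \<open>q\<close>, with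
  \<open>G = 1\<close>. Since \<open>inverse 0 = 0\<close>, it vanishes at
  \<open>q = p\<close>.\<close>

definition newton :: "'a::real_inner \<Rightarrow> 'a \<Rightarrow> 'a" where
  "newton p q = (q - p) /\<^sub>R norm (q - p) ^ 3"

text \<open>For \<open>q \<noteq> p\<close>, the derivative of the kernel with respect to its first
  argument, at \<open>p\<close> in the direction \<open>v\<close> (the tidal tensor applied to
  \<open>v\<close>).\<close>

definition newton_deriv :: "'a::real_inner \<Rightarrow> 'a \<Rightarrow> 'a \<Rightarrow> 'a" where
  "newton_deriv p v q =
    (3 * ((q - p) \<bullet> v) / norm (q - p) ^ 5) *\<^sub>R (q - p) - v /\<^sub>R norm (q - p) ^ 3"

lemma norm_newton: "norm (newton p q) = 1 / norm (q - p) ^ 2"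
  unfolding newton_def norm_scaleR
  by (cases "q = p") (auto simp: divide_simps power_numeral_reduce)

text \<open>The constant is 3 + 1: Cauchy-Schwarz bounds the first summand with factor 3, and the
  second has factor 1.\<close>

lemma norm_newton_deriv_le: "norm (newton_deriv p v q) \<le> 4 * norm v / norm (q - p) ^ 3"
proof (cases "q = p")
  case False
  have "norm ((3 * ((q - p) \<bullet> v) / norm (q - p) ^ 5) *\<^sub>R (q - p)) \<le>
      3 * (norm (q - p) * norm v) / norm (q - p) ^ 5 * norm (q - p)"
    using Cauchy_Schwarz_ineq2[of "q - p" v]
    by (auto simp: abs_mult intro!: mult_right_mono divide_right_mono)
  also have "\<dots> = 3 * norm v / norm (q - p) ^ 3"
    using False by (simp add: field_simps power_numeral_reduce)
  finally have "norm ((3 * ((q - p) \<bullet> v) / norm (q - p) ^ 5) *\<^sub>R (q - p)) \<le> 3 * norm v / norm (q - p) ^ 3" .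
  moreover have "norm (v /\<^sub>R norm (q - p) ^ 3) = norm v / norm (q - p) ^ 3"
    by (simp add: divide_inverse mult.commute)
  ultimately show ?thesis
    unfolding newton_deriv_def
    by (intro order_trans[OF norm_triangle_ineq4]) (simp add: add_divide_distrib)
qed (simp add: newton_deriv_def)

lemma norm_newton_deriv_le_near:
  assumes "0 < \<delta>" "\<delta> \<le> norm (q - p)"
  shows "norm (newton_deriv p v q) \<le> 4 * norm v / \<delta> ^ 3"
  using assms
  by (intro order_trans[OF norm_newton_deriv_le] divide_left_mono power_mono mult_pos_pos zero_less_power) auto

lemma newton_has_vector_derivative:
  assumes "q \<noteq> p + t *\<^sub>R v"
  shows "((\<lambda>t. newton (p + t *\<^sub>R v) q) has_vector_derivative newton_deriv (p + t *\<^sub>R v) v q) (at t)"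
proof -
  define d where "d t = q - (p + t *\<^sub>R v)" for t
  have d: "d t \<noteq> 0" using assms by (auto simp: d_def)
  have dd: "(d has_vector_derivative - v) (at t)"
    unfolding d_def by (auto intro!: derivative_eq_intros)
  have "((\<lambda>t. norm (d t)) has_real_derivative - (d t \<bullet> v) / norm (d t)) (at t)"
    unfolding has_field_derivative_def
    by (rule has_derivative_eq_rhs[OF has_derivative_norm[THEN has_derivative_compose[OF dd[unfolded has_vector_derivative_def]]]])
      (use d in \<open>auto simp: sgn_div_norm inner_commute divide_inverse\<close>)
  then have "((\<lambda>t. inverse (norm (d t) ^ 3)) has_real_derivative 3 * (d t \<bullet> v) / norm (d t) ^ 5) (at t)"
    using d by (auto intro!: derivative_eq_intros simp: field_simps power_numeral_reduce)
  then have "((\<lambda>t. inverse (norm (d t) ^ 3) *\<^sub>R d t) has_vector_derivative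
      inverse (norm (d t) ^ 3) *\<^sub>R (- v) + (3 * (d t \<bullet> v) / norm (d t) ^ 5) *\<^sub>R d t) (at t)"
    by (rule has_vector_derivative_scaleR) (rule dd)
  then show ?thesis
    by (simp add: d_def newton_def newton_deriv_def)
qed

text \<open>The kernel is divergence free away from its source. Dimension three enters here: the
  three copies of \<open>1 / norm d ^ 3\<close> cancel
  \<open>3 / norm d ^ 5 * (d \<bullet> d)\<close>.\<close>

lemma newton_deriv_trace:
  fixes p q :: "real^3"
  shows "(\<Sum>i\<in>UNIV. newton_deriv p (axis i 1) q $ i) = 0"
proof (cases "q = p")
  case False
  define d where "d = q - p"
  have "d \<noteq> 0" using False by (simp add: d_def)
  have "(\<Sum>i\<in>UNIV. newton_deriv p (axis i 1) q $ i)
      = (\<Sum>i\<in>UNIV. 3 / norm d ^ 5 * (d $ i * d $ i) - 1 / norm d ^ 3)"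
    by (rule sum.cong) (simp_all add: newton_deriv_def inner_axis d_def divide_inverse)
  also have "\<dots> = 3 / norm d ^ 5 * (d \<bullet> d) - 3 / norm d ^ 3"
    by (simp add: sum_subtractf inner_vec_def sum_distrib_left)
  also have "\<dots> = 0"
    using \<open>d \<noteq> 0\<close> by (simp add: dot_square_norm field_simps power_numeral_reduce)
  finally show ?thesis .
qed (simp add: newton_deriv_def)

lemma newton_orthogonal:
  assumes "orthogonal_transformation f"
  shows "newton (f p) (f q) = f (newton p q)"
proof -
  interpret linear f using assms by (rule orthogonal_transformation_linear)
  show ?thesis
    using orthogonal_transformation_norm[OF assms]
    by (simp add: newton_def scale flip: diff)
qed

lemma borel_measurable_newton [measurable]:
  "newton p \<in> borel_measurable (borel :: 'a::euclidean_space measure)"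
  unfolding newton_def by measurable

lemma borel_measurable_newton_deriv [measurable]:
  "newton_deriv p v \<in> borel_measurable (borel :: 'a::euclidean_space measure)"
  unfolding newton_deriv_def by measurable


section \<open>Bodies centered at the origin: integrability and differentiability of the
  field\<close>

text \<open>Rotation by \<pi> about the first axis. Both transverse signs are flipped, so the
  determinant is 1.\<close>

definition half_turn :: "real^3^3" where
  "half_turn = (\<chi> i j. if i = j then if i = 1 then 1 else - 1 else 0)"

lemma rotation_half_turn: "rotation_matrix half_turn"
  by (simp add: rotation_matrix_def orthogonal_matrix half_turn_def det_3 vec_eq_iff
      matrix_matrix_mult_def transpose_def mat_def forall_3 sum_3)

lemma half_turn_mult: "half_turn *v x = vector [x $ 1, - x $ 2, - x $ 3]"
  by (simp add: half_turn_def vec_eq_iff matrix_vector_mult_def forall_3 sum_3)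

locale spherical_body = finite_measure \<mu> for \<mu> :: "(real^3) measure" +
  fixes R :: real
  assumes R_nonneg: "0 \<le> R"
    and sets_eq [measurable_cong]: "sets \<mu> = sets borel"
    and supp: "AE q in \<mu>. norm q \<le> R"
    and rotation_invariant: "rotation_matrix A \<Longrightarrow> distr \<mu> borel ((*v) A) = \<mu>"
begin

definition attraction :: "real^3 \<Rightarrow> real^3" where
  "attraction p = (LINT q|\<mu>. newton p q)"

text \<open>Outside the body the distance to almost every mass element is bounded below, so the
  kernels are essentially bounded and hence integrable for the finite measure.\<close>

lemma AE_dist: "AE q in \<mu>. norm p - R \<le> norm (q - p)"
  using supp by eventually_elim (use norm_triangle_ineq3[of _ p] in \<open>smt (verit)\<close>)

lemma integrable_newton:
  assumes "R < norm p"
  shows "integrable \<mu> (newton p)"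
proof (rule integrable_const_bound)
  show "AE q in \<mu>. norm (newton p q) \<le> 1 / (norm p - R) ^ 2"
    using AE_dist[of p]
    by eventually_elim (use assms in \<open>auto simp: norm_newton intro!: divide_left_mono power_mono mult_pos_pos zero_less_power\<close>)
qed measurable

lemma integrable_newton_deriv:
  assumes "R < norm p"
  shows "integrable \<mu> (newton_deriv p v)"
proof (rule integrable_const_bound)
  show "AE q in \<mu>. norm (newton_deriv p v q) \<le> 4 * norm v / (norm p - R) ^ 3"
    using AE_dist[of p]
    by eventually_elim (use assms in \<open>intro norm_newton_deriv_le_near, auto\<close>)
qed measurable

lemma attraction_has_vector_derivative:
  assumes "R < norm (p + x *\<^sub>R v)"
  shows "((\<lambda>t. attraction (p + t *\<^sub>R v)) has_vector_derivative
    (LINT q|\<mu>. newton_deriv (p + x *\<^sub>R v) v q)) (at x)"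
proof -
  \<comment> \<open>A radius strictly between the body and the point: for \<open>t\<close> near
    \<open>x\<close> the moving point stays outside this larger ball, which leaves a uniform gap
    \<open>\<rho> - R\<close> and a constant dominating function.\<close>
  define \<rho> where "\<rho> = (norm (p + x *\<^sub>R v) + R) / 2"
  have \<rho>: "R < \<rho>" "\<rho> < norm (p + x *\<^sub>R v)"
    using assms by (auto simp: \<rho>_def)
  have "open {t. \<rho> < norm (p + t *\<^sub>R v)}"
    by (intro open_Collect_less continuous_intros)
  then obtain e where e: "0 < e" "ball x e \<subseteq> {t. \<rho> < norm (p + t *\<^sub>R v)}"
    using \<rho> by (auto simp: open_contains_ball)
  have far: "AE q in \<mu>. \<forall>t\<in>ball x e. \<rho> - R \<le> norm (q - (p + t *\<^sub>R v))"
    using supp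
  proof (eventually_elim, intro ballI)
    fix q :: "real^3" and t assume "norm q \<le> R" "t \<in> ball x e"
    then show "\<rho> - R \<le> norm (q - (p + t *\<^sub>R v))"
      using e norm_triangle_ineq3[of q "p + t *\<^sub>R v"] by fastforce
  qed
  show ?thesis
    unfolding attraction_def
  proof (rule has_vector_derivative_integral[where S = "ball x e"
        and w = "\<lambda>_. 4 * norm v / (\<rho> - R) ^ 3"])
    show "integrable \<mu> (newton (p + t *\<^sub>R v))" if "t \<in> ball x e" for t
      using that e(2) \<rho>(1) by (intro integrable_newton) fastforce
    show "AE q in \<mu>. \<forall>t\<in>ball x e. ((\<lambda>t. newton (p + t *\<^sub>R v) q) has_vector_derivative
        newton_deriv (p + t *\<^sub>R v) v q) (at t)"
      using far
      by eventually_elim (use \<rho>(1) in \<open>fastforce intro: newton_has_vector_derivative\<close>)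
    show "AE q in \<mu>. \<forall>t\<in>ball x e. norm (newton_deriv (p + t *\<^sub>R v) v q)
        \<le> 4 * norm v / (\<rho> - R) ^ 3"
      using far
      by eventually_elim (use \<rho>(1) in \<open>auto intro: norm_newton_deriv_le_near\<close>)
  qed (use e in \<open>auto\<close>)
qed

section \<open>Rotational symmetry: the field is radial\<close>

text \<open>Substitute \<open>A *v q\<close> for \<open>q\<close>, which preserves the measure, and
  use that the kernel commutes with orthogonal maps.\<close>

lemma attraction_rotation:
  assumes "rotation_matrix A" "R < norm p"
  shows "attraction (A *v p) = A *v attraction p"
proof -
  have A: "orthogonal_transformation ((*v) A)"
    using assms(1) by (simp add: rotation_matrix_def orthogonal_transformation_matrix)
  have [measurable]: "(*v) A \<in> borel_measurable borel"
    by (intro borel_measurable_continuous_onI matrix_vector_mult_linear_continuous_on)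
  have "attraction (A *v p) = (LINT q|distr \<mu> borel ((*v) A). newton (A *v p) q)"
    by (simp add: attraction_def rotation_invariant[OF assms(1)])
  also have "\<dots> = (LINT q|\<mu>. newton (A *v p) (A *v q))"
    by (rule integral_distr) measurable
  also have "\<dots> = (LINT q|\<mu>. A *v newton p q)"
    by (simp add: newton_orthogonal[OF A])
  also have "\<dots> = A *v attraction p"
    unfolding attraction_def
    by (rule integral_bounded_linear) (use assms in \<open>simp_all add: integrable_newton\<close>)
  finally show ?thesis .
qed

text \<open>The half turn fixes the points of the axis, hence also the force there; but it negates
  the two transverse components, so these vanish.\<close>

lemma attraction_axis:
  assumes "R < r"
  shows "attraction (r *\<^sub>R axis 1 1) = (attraction (r *\<^sub>R axis 1 1) $ 1) *\<^sub>R axis 1 1"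
proof -
  have "half_turn *v (r *\<^sub>R axis 1 1) = r *\<^sub>R axis 1 1"
    by (simp add: half_turn_mult vec_eq_iff forall_3 axis_def)
  then have "half_turn *v attraction (r *\<^sub>R axis 1 1) = attraction (r *\<^sub>R axis 1 1)"
    using attraction_rotation[OF rotation_half_turn, of "r *\<^sub>R axis 1 1"] assms R_nonneg
    by simp
  then show ?thesis
    by (simp add: half_turn_mult vec_eq_iff forall_3 axis_def)
qed

text \<open>Some rotation carries the first axis to the direction of \<open>p\<close>; equivariance
  transports the result on the axis to \<open>p\<close>.\<close>

lemma attraction_radial:
  assumes "R < norm p"
  shows "attraction p = (attraction (norm p *\<^sub>R axis 1 1) $ 1) *\<^sub>R (p /\<^sub>R norm p)"
proof -
  have p: "norm p > 0" using assms R_nonneg by linarith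
  then have "norm (p /\<^sub>R norm p) = 1" by simp
  then obtain A :: "real^3^3" where A: "rotation_matrix A" "A *v axis 1 1 = p /\<^sub>R norm p"
    by (rule rotation_matrix_exists_basis[of "p /\<^sub>R norm p" 1, rotated]) simp_all
  have "attraction p = attraction (A *v (norm p *\<^sub>R axis 1 1))"
    using p by (simp add: matrix_vector_mult_scaleR A)
  also have "\<dots> = A *v attraction (norm p *\<^sub>R axis 1 1)"
    using A assms p by (intro attraction_rotation) auto
  also have "\<dots> = A *v ((attraction (norm p *\<^sub>R axis 1 1) $ 1) *\<^sub>R axis 1 1)"
    using attraction_axis[OF assms] by simp
  finally show ?thesis
    by (simp add: matrix_vector_mult_scaleR A)
qed

section \<open>Vanishing divergence and the radial differential equation\<close>

text \<open>Along the line through \<open>r *\<^sub>R axis 1 1\<close> in direction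
  \<open>axis i 1\<close> the force stays parallel to the position vector. Differentiating this
  proportionality at \<open>t = 0\<close> gives the transverse derivative without computing the
  integral.\<close>

lemma attraction_deriv_transverse:
  assumes "R < r" "i \<noteq> 1"
  shows "(LINT q|\<mu>. newton_deriv (r *\<^sub>R axis 1 1) (axis i 1) q) $ i
    = attraction (r *\<^sub>R axis 1 1) $ 1 / r"
proof -
  define D where "D = (LINT q|\<mu>. newton_deriv (r *\<^sub>R axis 1 1) (axis i 1) q)"
  define F where "F t = attraction (r *\<^sub>R axis 1 1 + t *\<^sub>R axis i 1)" for t
  have "r > 0" using assms R_nonneg by simp
  have "(F has_vector_derivative D) (at 0)"
    using attraction_has_vector_derivative[of "r *\<^sub>R axis 1 1" 0 "axis i 1"] assms R_nonneg
    by (simp add: F_def[abs_def] D_def norm_axis_1)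
  then have F: "((\<lambda>t. F t $ j) has_real_derivative D $ j) (at 0)" for j
    unfolding has_real_derivative_iff_has_vector_derivative
    by (rule bounded_linear.has_vector_derivative[OF bounded_linear_vec_nth])
  have eq: "F t $ i * r = F t $ 1 * t" for t
  proof -
    let ?p = "r *\<^sub>R axis 1 1 + t *\<^sub>R axis i 1 :: real^3"
    \<comment> \<open>The first coordinate is \<open>r\<close> on the whole line, so the line never
      meets the body.\<close>
    have "\<bar>?p $ 1\<bar> \<le> norm ?p" by (rule component_le_norm_cart)
    then have "R < norm ?p" using assms by (simp add: axis_def)
    from attraction_radial[OF this] show ?thesis
      using assms(2) by (simp add: F_def axis_def)
  qed
  have "((\<lambda>t. F t $ i * r) has_real_derivative D $ i * r) (at 0)"
    by (rule DERIV_cmult_right[OF F])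
  \<comment> \<open>In the product rule the term with the derivative of \<open>F t $ 1\<close>
    carries the factor \<open>t = 0\<close>.\<close>
  moreover have "((\<lambda>t. F t $ 1 * t) has_real_derivative F 0 $ 1) (at 0)"
    using DERIV_mult[OF F[of 1] DERIV_ident] by simp
  ultimately have "D $ i * r = F 0 $ 1"
    unfolding eq by (rule DERIV_unique)
  then show ?thesis
    using \<open>r > 0\<close> by (simp add: D_def F_def field_simps)
qed

lemma attraction_divergence:
  assumes "R < norm p"
  shows "(\<Sum>i\<in>UNIV. integral\<^sup>L \<mu> (newton_deriv p (axis i 1)) $ i) = 0"
proof -
  have "(\<Sum>i\<in>UNIV. integral\<^sup>L \<mu> (newton_deriv p (axis i 1)) $ i)
      = (\<Sum>i\<in>UNIV. LINT q|\<mu>. newton_deriv p (axis i 1) q $ i)"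
    by (intro sum.cong refl integral_bounded_linear[symmetric] bounded_linear_vec_nth
        integrable_newton_deriv assms)
  also have "\<dots> = (LINT q|\<mu>. (\<Sum>i\<in>UNIV. newton_deriv p (axis i 1) q $ i))"
    by (intro Bochner_Integration.integral_sum[symmetric]
        integrable_bounded_linear[OF bounded_linear_vec_nth] integrable_newton_deriv assms)
  finally show ?thesis by (simp add: newton_deriv_trace)
qed

text \<open>The radial term of the divergence must cancel the two equal transverse ones.\<close>

lemma attraction_axis_deriv:
  assumes "R < r"
  shows "((\<lambda>r. attraction (r *\<^sub>R axis 1 1) $ 1) has_real_derivative
    - 2 * attraction (r *\<^sub>R axis 1 1) $ 1 / r) (at r)"
proof -
  let ?D = "\<lambda>i. LINT q|\<mu>. newton_deriv (r *\<^sub>R axis 1 1) (axis i 1) q"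
  have r: "R < norm (r *\<^sub>R axis 1 1 :: real^3)" using assms R_nonneg by simp
  have "?D 1 $ 1 = - 2 * attraction (r *\<^sub>R axis 1 1) $ 1 / r"
    using attraction_divergence[OF r] attraction_deriv_transverse[OF assms]
    by (simp add: sum_3)
  moreover have "((\<lambda>r. attraction (r *\<^sub>R axis 1 1)) has_vector_derivative ?D 1) (at r)"
    using attraction_has_vector_derivative[of 0 r "axis 1 1"] r by simp
  then have "((\<lambda>r. attraction (r *\<^sub>R axis 1 1) $ 1) has_real_derivative ?D 1 $ 1) (at r)"
    unfolding has_real_derivative_iff_has_vector_derivative
    by (rule bounded_linear.has_vector_derivative[OF bounded_linear_vec_nth])
  ultimately show ?thesis by simp
qed

text \<open>By the differential equation the two terms of the derivative of the product,
  \<open>2 * r\<close> and \<open>- 2 * r\<close> times the radial component, cancel on the convex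
  set \<open>{R<..}\<close>.\<close>

lemma attraction_axis_const:
  obtains c where "\<And>r. R < r \<Longrightarrow> r ^ 2 * attraction (r *\<^sub>R axis 1 1) $ 1 = c"
proof -
  have "\<exists>c. \<forall>r\<in>{R<..}. r ^ 2 * attraction (r *\<^sub>R axis 1 1) $ 1 = c"
  proof (rule has_field_derivative_zero_constant)
    fix r assume "r \<in> {R<..}"
    then have "r > 0" "R < r" using R_nonneg by auto
    then show "((\<lambda>r. r ^ 2 * attraction (r *\<^sub>R axis 1 1) $ 1) has_real_derivative 0)
        (at r within {R<..})"
      by (auto intro!: derivative_eq_intros DERIV_subset[OF attraction_axis_deriv]
          simp: field_simps power2_eq_square)
  qed simp
  then show thesis using that by auto
qed

section \<open>Behavior at infinity and the value of the constant\<close>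

text \<open>From far away every mass element appears in direction \<open>- axis 1 1\<close> at
  distance asymptotic to \<open>r\<close>; dominated convergence then yields the total mass.\<close>

lemma attraction_axis_limit:
  "((\<lambda>r. r ^ 2 *\<^sub>R attraction (r *\<^sub>R axis 1 1)) \<longlongrightarrow> - measure \<mu> UNIV *\<^sub>R axis 1 1) at_top"
proof -
  let ?e = "axis 1 1 :: real^3"
  have "((\<lambda>r. LINT q|\<mu>. r ^ 2 *\<^sub>R newton (r *\<^sub>R ?e) q) \<longlongrightarrow> (LINT q|\<mu>. - ?e)) at_top"
  proof (rule integral_dominated_convergence_at_top)
    \<comment> \<open>For \<open>r > 2 * R\<close> almost all mass lies at distance at least
      \<open>r / 2\<close>, and \<open>r ^ 2 / (r / 2) ^ 2 = 4\<close>.\<close>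
    show "\<forall>\<^sub>F r in at_top. AE q in \<mu>. norm (r ^ 2 *\<^sub>R newton (r *\<^sub>R ?e) q) \<le> 4"
      using eventually_gt_at_top[of "2 * R"]
    proof eventually_elim
      fix r assume r: "2 * R < r"
      then have "r > 0" using R_nonneg by simp
      have "AE q in \<mu>. r / 2 \<le> norm (q - r *\<^sub>R ?e)"
        using AE_dist[of "r *\<^sub>R ?e"] by eventually_elim (use r \<open>r > 0\<close> in \<open>simp\<close>)
      then show "AE q in \<mu>. norm (r ^ 2 *\<^sub>R newton (r *\<^sub>R ?e) q) \<le> 4"
      proof eventually_elim
        fix q assume q: "r / 2 \<le> norm (q - r *\<^sub>R ?e)"
        then have "(r / 2) ^ 2 \<le> norm (q - r *\<^sub>R ?e) ^ 2"
          using \<open>r > 0\<close> by (intro power_mono) auto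
        then show "norm (r ^ 2 *\<^sub>R newton (r *\<^sub>R ?e) q) \<le> 4"
          using q \<open>r > 0\<close>
          by (auto simp: norm_newton power_divide divide_le_eq zero_less_power)
      qed
    qed
    show "AE q in \<mu>. ((\<lambda>r. r ^ 2 *\<^sub>R newton (r *\<^sub>R ?e) q) \<longlongrightarrow> - ?e) at_top"
    proof (rule AE_I2)
      fix q
      have "((\<lambda>r. inverse r *\<^sub>R q - ?e) \<longlongrightarrow> 0 *\<^sub>R q - ?e) at_top"
        by (intro tendsto_intros tendsto_inverse_0_at_top filterlim_ident)
      then have lim: "((\<lambda>r. inverse r *\<^sub>R q - ?e) \<longlongrightarrow> - ?e) at_top" by simp
      have "((\<lambda>r. (inverse r *\<^sub>R q - ?e) /\<^sub>R norm (inverse r *\<^sub>R q - ?e) ^ 3)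
          \<longlongrightarrow> (- ?e) /\<^sub>R norm (- ?e) ^ 3) at_top"
        by (intro tendsto_intros lim) simp
      \<comment> \<open>The kernel is homogeneous of degree -2, so the factor \<open>r ^ 2\<close>
        amounts to shrinking the configuration by \<open>r\<close>.\<close>
      moreover have "\<forall>\<^sub>F r in at_top. (inverse r *\<^sub>R q - ?e) /\<^sub>R norm (inverse r *\<^sub>R q - ?e) ^ 3
          = r ^ 2 *\<^sub>R newton (r *\<^sub>R ?e) q"
        using eventually_gt_at_top[of 0]
      proof eventually_elim
        fix r :: real assume "r > 0"
        then have "inverse r *\<^sub>R q - ?e = inverse r *\<^sub>R (q - r *\<^sub>R ?e)"
          by (simp add: scaleR_diff_right)
        with \<open>r > 0\<close> show "(inverse r *\<^sub>R q - ?e) /\<^sub>R norm (inverse r *\<^sub>R q - ?e) ^ 3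
          = r ^ 2 *\<^sub>R newton (r *\<^sub>R ?e) q"
          by (simp add: newton_def power_mult_distrib power_inverse)
             (simp add: field_simps power_numeral_reduce)
      qed
      ultimately show "((\<lambda>r. r ^ 2 *\<^sub>R newton (r *\<^sub>R ?e) q) \<longlongrightarrow> - ?e) at_top"
        by (auto elim: Lim_transform_eventually)
    qed
  qed measurable
  moreover have "space \<mu> = UNIV"
    using sets_eq_imp_space_eq[OF sets_eq] by simp
  ultimately show ?thesis
    by (simp add: attraction_def)
qed

text \<open>The constant equals its limit, minus the total mass; the sign is absorbed because
  \<open>newton p 0\<close> points along \<open>- p\<close>.\<close>

lemma attraction_eq:
  assumes "R < norm p"
  shows "attraction p = measure \<mu> UNIV *\<^sub>R newton p 0"
proof -
  obtain c where c: "\<And>r. R < r \<Longrightarrow> r ^ 2 * attraction (r *\<^sub>R axis 1 1) $ 1 = c"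
    using attraction_axis_const by blast
  have "((\<lambda>r. r ^ 2 * attraction (r *\<^sub>R axis 1 1) $ 1) \<longlongrightarrow> - measure \<mu> UNIV) at_top"
    using tendsto_vec_nth[OF attraction_axis_limit, of 1] by simp
  moreover have "((\<lambda>r. r ^ 2 * attraction (r *\<^sub>R axis 1 1) $ 1) \<longlongrightarrow> c) at_top"
  proof (rule tendsto_eventually)
    show "\<forall>\<^sub>F r in at_top. r ^ 2 * attraction (r *\<^sub>R axis 1 1) $ 1 = c"
      using eventually_gt_at_top[of R] by eventually_elim (rule c)
  qed
  ultimately have "c = - measure \<mu> UNIV"
    using tendsto_unique trivial_limit_at_top_linorder by blast
  moreover have "norm p > 0" using assms R_nonneg by linarith
  ultimately have "attraction (norm p *\<^sub>R axis 1 1) $ 1 = - measure \<mu> UNIV / norm p ^ 2"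
    using c[OF assms] by (simp add: field_simps)
  then show ?thesis
    unfolding attraction_radial[OF assms] newton_def
    by (simp add: divide_inverse power_numeral_reduce mult.assoc)
qed

end

section \<open>Transfer to an arbitrary center\<close>

theorem theorem5p1:
  fixes G R\<^sub>0 m\<^sub>1 M :: real and C P :: "real^3" and \<mu> :: "(real^3) measure"
  assumes "G > 0" and "R\<^sub>0 > 0" and "m\<^sub>1 > 0"
    and "sets \<mu> = sets borel" and "finite_measure \<mu>"
    and "supported_in \<mu> (cball C R\<^sub>0)"
    and "spherically_symmetric C \<mu>"
    and "M = measure \<mu> UNIV"
    and "norm (P - C) > R\<^sub>0"
  shows "integrable \<mu> (\<lambda>Q. (G * m\<^sub>1) *\<^sub>R ((Q - P) /\<^sub>R norm (Q - P) ^ 3)) \<and>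
    (LINT Q|\<mu>. (G * m\<^sub>1) *\<^sub>R ((Q - P) /\<^sub>R norm (Q - P) ^ 3)) =
      (G * m\<^sub>1 * M) *\<^sub>R ((C - P) /\<^sub>R norm (C - P) ^ 3)"
proof -
  note [measurable_cong] = \<open>sets \<mu> = sets borel\<close>
  interpret finite_measure \<mu> by fact
  \<comment> \<open>The body translated so that its center becomes the origin.\<close>
  define \<nu> where "\<nu> = distr \<mu> borel (\<lambda>x. x - C)"
  have space: "space \<mu> = UNIV"
    using sets_eq_imp_space_eq[OF \<open>sets \<mu> = sets borel\<close>] by simp
  have "spherical_body \<nu> R\<^sub>0"
  proof (intro spherical_body.intro spherical_body_axioms.intro)
    show "finite_measure \<nu>"
      unfolding \<nu>_def by (rule finite_measure_distr) measurable
    have "- cball C R\<^sub>0 \<in> null_sets \<mu>"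
      using assms(4,6) by (simp add: supported_in_def null_sets_def)
    from AE_not_in[OF this] show "AE q in \<nu>. norm q \<le> R\<^sub>0"
      unfolding \<nu>_def by (simp add: AE_distr_iff dist_norm norm_minus_commute)
  next
    fix A :: "real^3^3" assume A: "rotation_matrix A"
    have [measurable]: "(*v) A \<in> borel_measurable borel"
      by (intro borel_measurable_continuous_onI matrix_vector_mult_linear_continuous_on)
    then have [measurable]: "rotation_about C A \<in> borel_measurable borel"
      unfolding rotation_about_def[abs_def] by measurable
    have "distr \<nu> borel ((*v) A) = distr \<mu> borel (\<lambda>x. A *v (x - C))"
      unfolding \<nu>_def by (subst distr_distr) (measurable, simp add: comp_def)
    \<comment> \<open>Translation by \<open>- C\<close> conjugates the rotation about
      \<open>C\<close> to the one about the origin: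
      \<open>A *v (x - C) = rotation_about C A x - C\<close>.\<close>
    also have "\<dots> = distr (distr \<mu> borel (rotation_about C A)) borel (\<lambda>x. x - C)"
      by (subst distr_distr) (measurable, simp add: comp_def rotation_about_def)
    also have "\<dots> = \<nu>"
      using assms(7) A by (simp add: spherically_symmetric_def \<nu>_def)
    finally show "distr \<nu> borel ((*v) A) = \<nu>" .
  qed (use assms in \<open>auto simp: \<nu>_def\<close>)
  then interpret body: spherical_body \<nu> R\<^sub>0 .
  \<comment> \<open>The kernel depends only on the difference of its arguments, so the translation
    does not change the force.\<close>
  have newton: "newton (P - C) (x - C) = (x - P) /\<^sub>R norm (x - P) ^ 3" for x
    by (simp add: newton_def)
  have "integrable \<mu> (\<lambda>x. newton (P - C) (x - C))"
    using body.integrable_newton[OF assms(9)] unfolding \<nu>_def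
    by (subst (asm) integrable_distr_eq) auto
  moreover have "(LINT x|\<mu>. newton (P - C) (x - C)) = M *\<^sub>R newton (P - C) 0"
    using body.attraction_eq[OF assms(9)] assms(8) space
    unfolding body.attraction_def unfolding \<nu>_def by (simp add: integral_distr measure_distr)
  ultimately show ?thesis
    unfolding newton[symmetric] by simp
qed

end
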